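(* Let $\mathbf{k}$ be a field with $\mathrm{char}\,\mathbf{k}\neq 2$ and let $(A,\cdot,P,\mathcal{B}(\cdot,\cdot))$ be a unital commutative differential Frobenius algebra over $\mathbf{k}$. Let $\hat{P}:A\to A$ be the adjoint operator of $P$ with respect to $\mathcal{B}(\cdot,\cdot)$, i.e. $\mathcal{B}(P(a),b)=\mathcal{B}(a,\hat{P}(b))$ for all $a,b\in A$. Let $q\in\mathbf{k}$ and define $a\circ_q b:=a\cdot(P+q\hat{P})(b)$ for all $a,b\in A$. Then $(A,\cdot,\circ_q,\mathcal{B}(\cdot,\cdot))$ is a quadratic Jacobi Novikov-Poisson algebra if and only if $q=-\frac12$ or $\hat{P}$ is a derivation of $(A,\cdot)$.
   Context: Binary operations are bilinear. A unital commutative differential algebra $(A,\cdot,P)$ is a unital commutative associative algebra $(A,\cdot)$ with a derivation $P$. A unital commutative differential Frobenius algebra $(A,\cdot,P,\mathcal{B}(\cdot,\cdot))$ is a unital commutative differential algebra $(A,\cdot,P)$ with a nondegenerate symmetric bilinear form $\mathcal{B}$ satisfying $\mathcal{B}(a\cdot b,c)=\mathcal{B}(a,b\cdot c)$ for all $a,b,c\in A$. A Novikov algebra $(A,\circ)$ is a vector space with a binary operation satisfying $(a\circ b)\circ c-a\circ(b\circ c)=(b\circ a)\circ c-b\circ(a\circ c)$ and $(a\circ b)\circ c=(a\circ c)\circ b$. A Jacobi Novikov-Poisson algebra is a triple $(A,\cdot,\circ)$ where $(A,\cdot)$ is a unital commutative associative algebra with identity $1_A$, $(A,\circ)$ is a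 Novikov algebra, and $(a\cdot b)\circ c=a\cdot(b\circ c)$, $c\circ(a\cdot b)=(c\circ a)\cdot b+a\cdot(c\circ b)-a\cdot b\cdot(c\circ 1_A)$ for all $a,b,c\in A$. A quadratic Jacobi Novikov-Poisson algebra is $(A,\cdot,\circ,\mathcal{B}(\cdot,\cdot))$ with $(A,\cdot,\circ)$ a Jacobi Novikov-Poisson algebra and $\mathcal{B}$ a nondegenerate symmetric bilinear form with $\mathcal{B}(a\cdot b,c)=\mathcal{B}(a,b\cdot c)$ and $\mathcal{B}(a\circ b,c)=-\mathcal{B}(b,a\circ c+c\circ a)$ for all $a,b,c\in A$. *)

theory Defs
  imports Complex_Main
begin

definition bilinear_map ::
  "('k::field \<Rightarrow> 'a::ab_group_add \<Rightarrow> 'a) \<Rightarrow> ('k \<Rightarrow> 'b::ab_group_add \<Rightarrow> 'b) \<Rightarrow> ('a \<Rightarrow> 'a \<Rightarrow> 'b) \<Rightarrow> bool"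
  where "bilinear_map s t f \<longleftrightarrow>
    (\<forall>a. Vector_Spaces.linear s t (f a)) \<and> (\<forall>b. Vector_Spaces.linear s t (\<lambda>a. f a b))"

text \<open>
  The multiplication and the identity are parameters rather than the operations of
  \<^class>\<open>comm_ring_1\<close>, so that the zero algebra is included.
\<close>

locale unital_comm_algebra =
  vector_space scale + mult: comm_monoid mult one
  for scale :: "'k::field \<Rightarrow> 'a::ab_group_add \<Rightarrow> 'a"
    and mult :: "'a \<Rightarrow> 'a \<Rightarrow> 'a"
    and one :: 'a +
  assumes bilinear_mult: "bilinear_map scale scale mult"

definition derivation ::
  "('k::field \<Rightarrow> 'a::ab_group_add \<Rightarrow> 'a) \<Rightarrow> ('a \<Rightarrow> 'a \<Rightarrow> 'a) \<Rightarrow> ('a \<Rightarrow> 'a) \<Rightarrow> bool"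
  where "derivation scale mult D \<longleftrightarrow>
    Vector_Spaces.linear scale scale D \<and>
    (\<forall>a b. D (mult a b) = mult (D a) b + mult a (D b))"

locale differential_algebra = unital_comm_algebra scale mult one
  for scale :: "'k::field \<Rightarrow> 'a::ab_group_add \<Rightarrow> 'a"
    and mult :: "'a \<Rightarrow> 'a \<Rightarrow> 'a"
    and one :: 'a
    and P :: "'a \<Rightarrow> 'a" +
  assumes derivation_P: "derivation scale mult P"

text \<open>
  In infinite dimension, nondegeneracy means that the radical is trivial, not that
  the form identifies \<open>A\<close> with its dual. The field itself is a vector space
  with scalar multiplication \<open>(*)\<close>.
\<close>

definition nondegenerate_symmetric_form ::
  "('k::field \<Rightarrow> 'a::ab_group_add \<Rightarrow> 'a) \<Rightarrow> ('a \<Rightarrow> 'a \<Rightarrow> 'k) \<Rightarrow> bool"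
  where "nondegenerate_symmetric_form scale B \<longleftrightarrow>
    bilinear_map scale (*) B \<and>
    (\<forall>a b. B a b = B b a) \<and>
    (\<forall>a. (\<forall>b. B a b = 0) \<longrightarrow> a = 0)"

locale differential_Frobenius_algebra = differential_algebra scale mult one P
  for scale :: "'k::field \<Rightarrow> 'a::ab_group_add \<Rightarrow> 'a"
    and mult :: "'a \<Rightarrow> 'a \<Rightarrow> 'a"
    and one :: 'a
    and P :: "'a \<Rightarrow> 'a"
    and B :: "'a \<Rightarrow> 'a \<Rightarrow> 'k" +
  assumes form: "nondegenerate_symmetric_form scale B"
    and invariant: "B (mult a b) c = B a (mult b c)"

definition adjoint_operator :: "('a \<Rightarrow> 'a \<Rightarrow> 'k) \<Rightarrow> ('a \<Rightarrow> 'a) \<Rightarrow> ('a \<Rightarrow> 'a) \<Rightarrow> bool"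
  where "adjoint_operator B P P' \<longleftrightarrow> (\<forall>a b. B (P a) b = B a (P' b))"

locale Novikov_algebra = vector_space scale
  for scale :: "'k::field \<Rightarrow> 'a::ab_group_add \<Rightarrow> 'a"
    and circ :: "'a \<Rightarrow> 'a \<Rightarrow> 'a" +
  assumes bilinear_circ: "bilinear_map scale scale circ"
    and left_symmetric:
      "circ (circ a b) c - circ a (circ b c) = circ (circ b a) c - circ b (circ a c)"
    and right_commutative: "circ (circ a b) c = circ (circ a c) b"

locale Jacobi_Novikov_Poisson_algebra =
  unital_comm_algebra scale mult one + Novikov_algebra scale circ
  for scale :: "'k::field \<Rightarrow> 'a::ab_group_add \<Rightarrow> 'a"
    and mult :: "'a \<Rightarrow> 'a \<Rightarrow> 'a"
    and one :: 'a
    and circ :: "'a \<Rightarrow> 'a \<Rightarrow> 'a" +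
  assumes mult_circ: "circ (mult a b) c = mult a (circ b c)"
    and circ_mult:
      "circ c (mult a b) = mult (circ c a) b + mult a (circ c b) - mult (mult a b) (circ c one)"

locale quadratic_Jacobi_Novikov_Poisson_algebra =
  Jacobi_Novikov_Poisson_algebra scale mult one circ
  for scale :: "'k::field \<Rightarrow> 'a::ab_group_add \<Rightarrow> 'a"
    and mult :: "'a \<Rightarrow> 'a \<Rightarrow> 'a"
    and one :: 'a
    and circ :: "'a \<Rightarrow> 'a \<Rightarrow> 'a"
    and B :: "'a \<Rightarrow> 'a \<Rightarrow> 'k" +
  assumes form: "nondegenerate_symmetric_form scale B"
    and invariant: "B (mult a b) c = B a (mult b c)"
    and circ_invariant: "B (circ a b) c = - B b (circ a c + circ c a)"

definition circ_q ::
  "('k \<Rightarrow> 'a::ab_group_add \<Rightarrow> 'a) \<Rightarrow> ('a \<Rightarrow> 'a \<Rightarrow> 'a) \<Rightarrow> ('a \<Rightarrow> 'a) \<Rightarrow> ('a \<Rightarrow> 'a) \<Rightarrow> 'k \<Rightarrow> 'a \<Rightarrow> 'a \<Rightarrow> 'a"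
  where "circ_q scale mult P P' q a b = mult a (P b + scale q (P' b))"

end

theory Submission
  imports Defs
begin

text \<open>
  The invariance of the form turns the Leibniz rule of \<open>P\<close> into an identity for the adjoint,
  which forces \<open>P'\<close> to be \<open>b \<mapsto> e \<cdot> b - P b\<close> with \<open>e = P' 1\<close>. Two things
  follow.

  First, \<open>P'\<close> is a derivation iff \<open>e = 0\<close>: a derivation kills the identity, and for \<open>e = 0\<close>
  the adjoint is \<open>- P\<close>.

  Second, \<open>Q = P + q P'\<close> is a derivation plus a multiplication operator, so it satisfies the
  generalized Leibniz rule \<open>Q (x \<cdot> y) = Q x \<cdot> y + x \<cdot> Q y - x \<cdot> y \<cdot> Q 1\<close>. Any linear
  operator with this rule makes \<open>a \<circ> b = a \<cdot> Q b\<close> a Jacobi Novikov-Poisson product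
  (\<open>Jacobi_Novikov_Poisson_of_generalized_derivation\<close>), so that part of the structure exists
  for every \<open>q\<close>.

  Only the invariance of the form under \<open>\<circ>\<close> depends on \<open>q\<close>. Moving all operators to the
  second argument of the form and inserting the formula for \<open>P'\<close>, the terms with \<open>P\<close> cancel
  and the condition becomes \<open>(1 + 2 q) e = 0\<close> (\<open>circ_q_invariant_iff\<close>). In characteristic
  other than two this says that \<open>q = - 1/2\<close> or \<open>e = 0\<close>.
\<close>

section \<open>Products built from generalized derivations\<close>

context unital_comm_algebra
begin

lemma mult_add_right: "mult a (b + c) = mult a b + mult a c"
  and mult_add_left: "mult (a + b) c = mult a c + mult b c"
  and mult_scale_right: "mult a (scale r b) = scale r (mult a b)"
  and mult_scale_left: "mult (scale r a) b = scale r (mult a b)"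
  using bilinear_mult by (auto simp: bilinear_map_def Vector_Spaces.linear_iff)

lemma mult_diff_right: "mult a (b - c) = mult a b - mult a c"
  using mult_add_right[of a "b - c" c] by (simp add: eq_diff_eq)

lemma mult_diff_left: "mult (a - b) c = mult a c - mult b c"
  using mult_add_left[of "a - b" b c] by (simp add: eq_diff_eq)

lemma mult_zero_left: "mult 0 a = 0"
  using mult_diff_left[of 0 0 a] by simp

lemma mult_zero_right: "mult a 0 = 0"
  using mult_diff_right[of a 0 0] by simp

lemma mult_minus_left: "mult (- a) b = - mult a b"
  using mult_diff_left[of 0 a b] by (simp add: mult_zero_left)

lemma mult_minus_right: "mult a (- b) = - mult a b"
  using mult_diff_right[of a 0 b] by (simp add: mult_zero_right)

lemmas mult_distribs = mult_add_right mult_add_left mult_diff_right mult_diff_left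
  mult_scale_right mult_scale_left scale_right_distrib scale_right_diff_distrib

lemma derivation_one:
  assumes "derivation scale mult D"
  shows "D one = 0"
proof -
  have "D (mult one one) = mult (D one) one + mult one (D one)"
    using assms by (simp only: derivation_def)
  then show ?thesis
    by simp
qed

text \<open>
  The generalized Leibniz rule makes the associator
  \<open>(a \<circ> b) \<circ> c - a \<circ> (b \<circ> c)\<close> equal to
  \<open>a \<cdot> b \<cdot> (Q 1 \<cdot> Q c - Q (Q c))\<close>, which is visibly symmetric in \<open>a\<close> and \<open>b\<close>.
  Right commutativity comes from commutativity of the product, and the expansion of
  \<open>c \<circ> (a \<cdot> b)\<close> is the generalized Leibniz rule multiplied by \<open>c\<close>.
\<close>

lemma Jacobi_Novikov_Poisson_of_generalized_derivation:
  assumes linear_Q: "Vector_Spaces.linear scale scale Q"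
    and Leibniz: "\<And>x y. Q (mult x y) = mult (Q x) y + mult x (Q y) - mult (mult x y) (Q one)"
  shows "Jacobi_Novikov_Poisson_algebra scale mult one (\<lambda>a b. mult a (Q b))"
proof -
  have associator: "mult (mult a (Q b)) (Q c) - mult a (Q (mult b (Q c)))
      = mult (mult a b) (mult (Q one) (Q c) - Q (Q c))" for a b c
    by (simp add: Leibniz mult_distribs mult.assoc mult.commute mult.left_commute)
  have Q_add: "Q (x + y) = Q x + Q y" and Q_scale: "Q (scale r x) = scale r (Q x)" for x y r
    using linear_Q by (auto simp: Vector_Spaces.linear_iff)
  show ?thesis
  proof
    show "bilinear_map scale scale (\<lambda>a b. mult a (Q b))"
      using vector_space_axioms
      by (simp add: bilinear_map_def Vector_Spaces.linear_iff Q_add Q_scale mult_distribs)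
  next
    fix a b c
    show "mult (mult a (Q b)) (Q c) - mult a (Q (mult b (Q c)))
        = mult (mult b (Q a)) (Q c) - mult b (Q (mult a (Q c)))"
      unfolding associator by (simp add: mult.commute)
    show "mult (mult a (Q b)) (Q c) = mult (mult a (Q c)) (Q b)"
      by (simp add: mult.assoc mult.commute[of "Q b"])
    show "mult (mult a b) (Q c) = mult a (mult b (Q c))"
      by (rule mult.assoc)
    show "mult c (Q (mult a b)) = mult (mult c (Q a)) b + mult a (mult c (Q b))
        - mult (mult a b) (mult c (Q one))"
      by (simp add: Leibniz mult_distribs mult.assoc mult.commute mult.left_commute)
  qed
qed

end

section \<open>The adjoint of the derivation\<close>

context differential_Frobenius_algebra
begin

lemma P_mult: "P (mult a b) = mult (P a) b + mult a (P b)"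
  and P_add: "P (a + b) = P a + P b"
  and P_scale: "P (scale r a) = scale r (P a)"
  using derivation_P by (auto simp: derivation_def Vector_Spaces.linear_iff)

lemma form_add_left: "B (a + b) c = B a c + B b c"
  and form_add_right: "B a (b + c) = B a b + B a c"
  and form_scale_left: "B (scale r a) c = r * B a c"
  and form_scale_right: "B a (scale r c) = r * B a c"
  using form
  by (auto simp: nondegenerate_symmetric_form_def bilinear_map_def Vector_Spaces.linear_iff)

lemma form_commute: "B a b = B b a"
  using form unfolding nondegenerate_symmetric_form_def by blast

lemma form_diff_right: "B a (b - c) = B a b - B a c"
  using form_add_right[of a "b - c" c] by simp

lemma eq_by_form:
  assumes "\<And>x. B x a = B x b"
  shows "a = b"
proof -
  have "\<forall>x. B (a - b) x = 0"
    using assms form_commute form_diff_right by simp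
  then have "a - b = 0"
    using form unfolding nondegenerate_symmetric_form_def by blast
  then show ?thesis
    by simp
qed

lemma adjoint_eq:
  assumes "adjoint_operator B P P'"
  shows "P' b = mult (P' one) b - P b"
proof -
  have adj: "B (P x) y = B x (P' y)" for x y
    using assms by (simp add: adjoint_operator_def)
  \<comment> \<open>The form on \<open>P (x \<cdot> b)\<close> and \<open>1\<close> is evaluated in two ways: by adjointness and by the
    Leibniz rule.\<close>
  have "mult (P' one) b = P' b + P b"
  proof (rule eq_by_form)
    fix x
    have "B x (mult (P' one) b) = B (P (mult x b)) one"
      by (simp add: adj invariant mult.commute[of b])
    also have "\<dots> = B (P x) b + B x (P b)"
      by (simp add: P_mult form_add_left invariant)
    finally show "B x (mult (P' one) b) = B x (P' b + P b)"
      by (simp add: adj form_add_right)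
  qed
  then show ?thesis
    by simp
qed

lemma derivation_adjoint_iff:
  assumes "adjoint_operator B P P'"
  shows "derivation scale mult P' \<longleftrightarrow> P' one = 0"
proof
  assume "derivation scale mult P'"
  then show "P' one = 0"
    by (rule derivation_one)
next
  assume "P' one = 0"
  then have "P' b = - P b" for b
    using adjoint_eq[OF assms, of b] by (simp add: mult_zero_left)
  then have "P' = (\<lambda>b. - P b)"
    by blast
  then show "derivation scale mult P'"
    using vector_space_axioms
    by (simp add: derivation_def Vector_Spaces.linear_iff P_add P_scale P_mult
        scale_minus_right mult_minus_left mult_minus_right)
qed

section \<open>The deformed product\<close>

lemma Jacobi_Novikov_Poisson_circ_q:
  assumes "adjoint_operator B P P'"
  shows "Jacobi_Novikov_Poisson_algebra scale mult one (circ_q scale mult P P' q)"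
proof -
  define Q where "Q = (\<lambda>b. P b + scale q (P' b))"
  note P'_eq = adjoint_eq[OF assms]
  have P_one: "P one = 0"
    using derivation_P by (rule derivation_one)
  have P'_add: "P' (a + b) = P' a + P' b" and P'_scale: "P' (scale r a) = scale r (P' a)" for a b r
    using P'_eq[of "a + b"] P'_eq[of a] P'_eq[of b] P'_eq[of "scale r a"]
    by (simp_all add: P_add P_scale mult_distribs)
  have P'_mult: "P' (mult a b) = mult (P' a) b + mult a (P' b) - mult (mult a b) (P' one)" for a b
    using P'_eq[of "mult a b"] P'_eq[of a] P'_eq[of b]
    by (simp add: P_mult mult_distribs mult.assoc mult.commute mult.left_commute)
  have "Jacobi_Novikov_Poisson_algebra scale mult one (\<lambda>a b. mult a (Q b))"
  proof (rule Jacobi_Novikov_Poisson_of_generalized_derivation)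
    show "Vector_Spaces.linear scale scale Q"
      using vector_space_axioms
      by (simp add: Vector_Spaces.linear_iff Q_def P_add P_scale P'_add P'_scale
          scale_right_distrib scale_left_commute)
    show "Q (mult x y) = mult (Q x) y + mult x (Q y) - mult (mult x y) (Q one)" for x y
      by (simp add: Q_def P_mult P'_mult P_one mult_distribs)
  qed
  moreover have "(\<lambda>a b. mult a (Q b)) = circ_q scale mult P P' q"
    by (simp add: fun_eq_iff Q_def circ_q_def)
  ultimately show ?thesis
    by simp
qed

text \<open>
  The adjoint of \<open>P + q P'\<close> is \<open>P' + q P\<close>, so every term can be written as the form paired with
  \<open>b\<close>. The elements paired with \<open>b\<close> are \<open>P' (a \<cdot> c) + q P (a \<cdot> c)\<close> and
  \<open>P (a \<cdot> c) + q (a \<cdot> P' c + c \<cdot> P' a)\<close>; eliminating \<open>P'\<close> by \<open>adjoint_eq\<close> leaves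
  only multiples of \<open>P' 1 \<cdot> a \<cdot> c\<close> in their sum.
\<close>

lemma circ_q_defect:
  assumes "adjoint_operator B P P'"
  shows "B (circ_q scale mult P P' q a b) c
      + B b (circ_q scale mult P P' q a c + circ_q scale mult P P' q c a)
    = B b (scale (1 + 2 * q) (mult (P' one) (mult a c)))"
proof -
  note P'_eq = adjoint_eq[OF assms]
  have adj: "B (P x) y = B x (P' y)" for x y
    using assms by (simp add: adjoint_operator_def)
  have adj': "B (P' x) y = B x (P y)" for x y
    using adj[of y x] by (simp add: form_commute)
  have "B (circ_q scale mult P P' q a b) c = B (P b + scale q (P' b)) (mult a c)"
    unfolding circ_q_def using mult.commute[of a] by (simp add: invariant)
  also have "\<dots> = B b (P' (mult a c) + scale q (P (mult a c)))"
    by (simp add: form_add_left form_add_right form_scale_left form_scale_right adj adj')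
  finally have "B (circ_q scale mult P P' q a b) c
      + B b (circ_q scale mult P P' q a c + circ_q scale mult P P' q c a)
    = B b (P' (mult a c) + scale q (P (mult a c))
      + (mult a (P c + scale q (P' c)) + mult c (P a + scale q (P' a))))"
    by (simp add: form_add_right circ_q_def)
  also have "P' (mult a c) + scale q (P (mult a c))
      + (mult a (P c + scale q (P' c)) + mult c (P a + scale q (P' a)))
    = scale (1 + 2 * q) (mult (P' one) (mult a c))"
  proof -
    have double: "scale (q * 2) x = scale q x + scale q x" for x
      using scale_left_distrib[of q q x] by (simp only: mult_2_right)
    show ?thesis
      unfolding P'_eq[of "mult a c"] P'_eq[of a] P'_eq[of c]
      by (simp add: P_mult mult_distribs scale_left_distrib double algebra_simps
          mult.assoc mult.commute mult.left_commute)
  qed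
  finally show ?thesis .
qed

lemma circ_q_invariant_iff:
  assumes "adjoint_operator B P P'"
  shows "(\<forall>a b c. B (circ_q scale mult P P' q a b) c
      = - B b (circ_q scale mult P P' q a c + circ_q scale mult P P' q c a))
    \<longleftrightarrow> scale (1 + 2 * q) (P' one) = 0" (is "?inv \<longleftrightarrow> _")
proof -
  have form_zero: "B b 0 = 0" for b
    using form_diff_right[of b 0 0] by simp
  have inv: "?inv \<longleftrightarrow> (\<forall>a b c. B b (scale (1 + 2 * q) (mult (P' one) (mult a c))) = 0)"
    unfolding circ_q_defect[OF assms, symmetric] eq_neg_iff_add_eq_0 ..
  show ?thesis
  proof
    assume ?inv
    then have "B b (scale (1 + 2 * q) (mult (P' one) (mult one one))) = B b 0" for b
      unfolding inv form_zero by blast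
    then show "scale (1 + 2 * q) (P' one) = 0"
      using eq_by_form[of "scale (1 + 2 * q) (mult (P' one) (mult one one))" 0] by simp
  next
    assume "scale (1 + 2 * q) (P' one) = 0"
    then have "scale (1 + 2 * q) (mult (P' one) x) = 0" for x
      by (simp only: mult_scale_left[symmetric] mult_zero_left)
    then show ?inv
      unfolding inv by (simp only: form_zero simp_thms)
  qed
qed

lemma quadratic_circ_q_iff:
  assumes "adjoint_operator B P P'"
  shows "quadratic_Jacobi_Novikov_Poisson_algebra scale mult one (circ_q scale mult P P' q) B
    \<longleftrightarrow> scale (1 + 2 * q) (P' one) = 0"
  unfolding quadratic_Jacobi_Novikov_Poisson_algebra_def
    quadratic_Jacobi_Novikov_Poisson_algebra_axioms_def circ_q_invariant_iff[OF assms]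
  using Jacobi_Novikov_Poisson_circ_q[OF assms] form invariant by blast

end

section \<open>The characterization\<close>

lemma two_neq_zero_if_CHAR_neq_2:
  assumes "CHAR('k::field) \<noteq> 2"
  shows "(2::'k) \<noteq> 0"
proof
  assume "(2::'k) = 0"
  then have "CHAR('k) dvd 2"
    using of_nat_eq_0_iff_char_dvd[where 'a = 'k, of 2] by simp
  then have "CHAR('k) = 1 \<or> CHAR('k) = 2"
    using dvd_imp_le[of "CHAR('k)" 2] by (cases "CHAR('k)") auto
  with assms show False
    using CHAR_not_1'[where 'a = 'k] by simp
qed

theorem proposition3p7:
  fixes scale :: "'k::field \<Rightarrow> 'a::ab_group_add \<Rightarrow> 'a"
    and mult :: "'a \<Rightarrow> 'a \<Rightarrow> 'a"
    and one :: 'a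
    and P P' :: "'a \<Rightarrow> 'a"
    and B :: "'a \<Rightarrow> 'a \<Rightarrow> 'k"
    and q :: 'k
  assumes "CHAR('k) \<noteq> 2"
    and "differential_Frobenius_algebra scale mult one P B"
    and "adjoint_operator B P P'"
  shows "quadratic_Jacobi_Novikov_Poisson_algebra scale mult one (circ_q scale mult P P' q) B
    \<longleftrightarrow> q = - (1 / 2) \<or> derivation scale mult P'"
proof -
  interpret differential_Frobenius_algebra scale mult one P B
    by fact
  have "1 + 2 * q = 0 \<longleftrightarrow> q = - (1 / 2)"
    using two_neq_zero_if_CHAR_neq_2[OF assms(1)]
    by (auto simp: field_simps eq_neg_iff_add_eq_0)
  then show ?thesis
    unfolding quadratic_circ_q_iff[OF assms(3)] derivation_adjoint_iff[OF assms(3)]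
    by simp
qed

end
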